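(* Consider an execution of $\mathsf{FLAC}$ for a transaction $T$ with participant set $\mathcal{C}_T$ and coordinator $C^*$. If the RLSM manager triggers a $CF$ event or an $NF$ event, then an unexpected failure indeed occurs during the execution of the transaction $T$.
   Context: **Model.** A coordinator $C^*$ and participants $\mathcal{C}_T=\{C_1,\dots,C_m\}$ process $T$. Each participant votes $Yes$ or $No$. Nodes may crash (crash failure). Every message is eventually delivered but may be delayed: for nodes $x,y$, $U(x,y)\ge 0$ is a fixed bound, and a message from $x$ to $y$ taking longer than $U(x,y)$ is a network failure. The coordinator is alive. Local processing time and clock skew are neglected. Network timeouts: $W_{C^*}=\max\{U(C^*,C_j)+U(C_j,C_i)+U(C_i,C^* ) : C_i,C_j\in\mathcal{C}_T\}$, counted from sending Propose; $W_{C_i}=\max\{t_{sent}+U(C^*,C_j)+U(C_j,C_i)-t_{recv} : C_j\in\mathcal{C}_T\}$, where $t_{sent},t_{recv}$ are the times at which $C^*$ sends and $C_i$ receives Propose. **Execution.** There are three robustness levels: $L_{\mathsf{FF}}$ (protocol $\mathsf{FLAC_{FF}}$; no failure is expected), $L_{\mathsf{CF}}$ (protocol $\mathsf{FLAC_{CF}}$; only crash failures are expected), $L_{\mathsf{NF}}$ (protocol $\mathsf{FLAC_{NF}}$; crash and network failures are both expected). An *unexpected failure* at a level is a failure not expected at that level. $T$ is executed at a level $L$, the most stringent level among its participants, with the corresponding protocol. $C^*$ broadcasts Propose to $\mathcal{C}_T$; each participant eventually sends one result $\langle\text{vote},\text{state}\rangle$ to $C^*$ (unless crashed). $\mathcal{R}_T$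 is the set of results that reach $C^*$ within $W_{C^*}$. In $\mathsf{FLAC_{FF}}$, participant $C_i$ on receiving Propose immediately broadcasts its vote to the other participants. If the vote is $No$ it sends $\langle No,Abort\rangle$ to $C^*$. If the vote is $Yes$: on receiving a $No$ vote within $W_{C_i}$ it sends $\langle Yes,Abort\rangle$; on receiving $Yes$ votes from all of $\mathcal{C}_T$ within $W_{C_i}$ it sends $\langle Yes,Commit\rangle$; otherwise, when $W_{C_i}$ expires, it sends $\langle Yes,Undecide\rangle$. In $\mathsf{FLAC_{CF}}$, participant $C_i$ on receiving Propose immediately broadcasts its vote to $\mathcal{C}_T$. If the vote is $No$ it broadcasts an $Abort$ decision and sends $\langle No,Abort\rangle$ to $C^*$. If the vote is $Yes$: on receiving $Yes$ votes from all of $\mathcal{C}_T$ within $W_{C_i}$ it sends $\langle Yes,Undecide\rangle$ to $C^*$; otherwise, by the time $W_{C_i}$ expires, it broadcasts an $Abort$ decision and sends $\langle Yes,Abort\rangle$ to $C^*$. **RLSM manager.** The robustness-level state machine (RLSM) manager, a component of $C^*$, triggers events as follows. - If $L=L_{\mathsf{FF}}$: if $|\mathcal{R}_T|<|\mathcal{C}_T|$, send $CF$ to the state machines of the participants whose result is not in $\mathcal{R}_T$, and send $NF$ to the state machines of those whose result arrives late, i.e. after $W_{C^*}$; else if $\langle Yes,Undecide\rangle\in\mathcal{R}_T$, send $NF$ to the state machines of all participants. - If $L=L_{\mathsf{CF}}$: if $|\mathcal{R}_T|<|\mathcal{C}_T|$, send $NF$ to the state machines of the participants whose result arrives late; else if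 $\langle Yes,Abort\rangle\in\mathcal{R}_T$ and no result with vote $No$ is in $\mathcal{R}_T$, send $NF$ to the state machines of all participants. - If $L=L_{\mathsf{NF}}$: no $CF$ or $NF$ event is triggered. *)

theory Defs
  imports Complex_Main
begin

datatype level = L_FF | L_CF | L_NF
datatype vote = Yes | No
datatype state = Commit | Abort | Undecide
datatype 'c node = Coord | Part 'c

text \<open>\<open>Other\<close> stands for all messages whose content plays no role here, such as those of the
  third protocol and the final decision of the coordinator.\<close>

datatype payload = Propose | Vote vote | Result vote state | Decision state | Other nat

datatype 'c message =
  Message (src: "'c node") (dst: "'c node") (payload: payload) (sent: real)

text \<open>
  One execution for a single transaction. Crashes are permanent; \<open>crash_time e c = None\<close> means that
  \<open>c\<close> never crashes, and the coordinator has no crash time since it stays alive. Each message in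
  \<open>msgs e\<close> is delivered \<open>delay e m\<close> time units after it was sent, so it may be arbitrarily late
  but never gets lost. \<open>delay_bound\<close> is the bound written \<open>U\<close> in the literature, \<open>start_time\<close> the
  time at which Propose is broadcast.
\<close>

record 'c execution =
  participants :: "'c set"
  participant_level :: "'c \<Rightarrow> level"
  delay_bound :: "'c node \<Rightarrow> 'c node \<Rightarrow> real"
  vote_of :: "'c \<Rightarrow> vote"
  crash_time :: "'c \<Rightarrow> real option"
  start_time :: real
  end_time :: real
  msgs :: "'c message set"
  delay :: "'c message \<Rightarrow> real"

definition arrival :: "'c execution \<Rightarrow> 'c message \<Rightarrow> real" where
  "arrival e m = sent m + delay e m"

definition exec_level :: "'c execution \<Rightarrow> level" where
  "exec_level e =
     (if L_NF \<in> participant_level e ` participants e then L_NF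
      else if L_CF \<in> participant_level e ` participants e then L_CF
      else L_FF)"


subsection \<open>Crashes\<close>

text \<open>
  At the very instant of its crash a node may still perform an initial part of its actions (for
  instance reach only some receivers of a broadcast). Hence there are two notions: a node that is
  \<open>alive\<close> performs all actions due, a node that is not \<open>can_act\<close> performs none.
\<close>

definition alive :: "'c execution \<Rightarrow> 'c \<Rightarrow> real \<Rightarrow> bool" where
  "alive e c t \<longleftrightarrow> (\<forall>s. crash_time e c = Some s \<longrightarrow> t < s)"

definition can_act :: "'c execution \<Rightarrow> 'c \<Rightarrow> real \<Rightarrow> bool" where
  "can_act e c t \<longleftrightarrow> (\<forall>s. crash_time e c = Some s \<longrightarrow> t \<le> s)"


subsection \<open>Proposal, timeouts and votes\<close>

definition propose_msg :: "'c execution \<Rightarrow> 'c \<Rightarrow> 'c message" where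
  "propose_msg e c = Message Coord (Part c) Propose (start_time e)"

definition recv_time :: "'c execution \<Rightarrow> 'c \<Rightarrow> real" where
  "recv_time e c = arrival e (propose_msg e c)"

definition coord_timeout :: "'c execution \<Rightarrow> real" where
  "coord_timeout e =
     Max {delay_bound e Coord (Part j) + delay_bound e (Part j) (Part i) + delay_bound e (Part i) Coord
          | i j. i \<in> participants e \<and> j \<in> participants e}"

definition part_timeout :: "'c execution \<Rightarrow> 'c \<Rightarrow> real" where
  "part_timeout e i =
     Max {start_time e + delay_bound e Coord (Part j) + delay_bound e (Part j) (Part i) - recv_time e i
          | j. j \<in> participants e}"

text \<open>The timeout of a participant is negative if Propose reaches it too late; it then expires at
  once.\<close>

definition part_deadline :: "'c execution \<Rightarrow> 'c \<Rightarrow> real" where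
  "part_deadline e i = max (recv_time e i) (recv_time e i + part_timeout e i)"

definition coord_deadline :: "'c execution \<Rightarrow> real" where
  "coord_deadline e = start_time e + coord_timeout e"

definition vote_receivers :: "'c execution \<Rightarrow> 'c \<Rightarrow> 'c set" where
  "vote_receivers e c =
     (if exec_level e = L_FF then participants e - {c} else participants e)"

definition vote_msg :: "'c execution \<Rightarrow> 'c \<Rightarrow> 'c \<Rightarrow> 'c message" where
  "vote_msg e c d = Message (Part c) (Part d) (Vote (vote_of e c)) (recv_time e c)"

text \<open>
  \<open>has_vote e i j t\<close>: the vote of \<open>j\<close> is available to \<open>i\<close> at time \<open>t\<close>. A vote that arrives before
  Propose is buffered. A participant that does not send its vote to itself knows it nevertheless.
\<close>

definition has_vote :: "'c execution \<Rightarrow> 'c \<Rightarrow> 'c \<Rightarrow> real \<Rightarrow> bool" where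
  "has_vote e i j t \<longleftrightarrow>
     (j = i \<and> i \<notin> vote_receivers e i) \<or>
     (vote_msg e j i \<in> msgs e \<and> arrival e (vote_msg e j i) \<le> t)"

definition got_no :: "'c execution \<Rightarrow> 'c \<Rightarrow> real \<Rightarrow> bool" where
  "got_no e i t \<longleftrightarrow> (\<exists>j\<in>participants e. vote_of e j = No \<and> has_vote e i j t)"

definition got_all_yes :: "'c execution \<Rightarrow> 'c \<Rightarrow> real \<Rightarrow> bool" where
  "got_all_yes e i t \<longleftrightarrow> (\<forall>j\<in>participants e. vote_of e j = Yes \<and> has_vote e i j t)"


subsection \<open>The protocols\<close>

text \<open>\<open>t\<close> is the first time from the receipt of Propose on at which \<open>P\<close> holds.\<close>

definition first_time :: "'c execution \<Rightarrow> 'c \<Rightarrow> (real \<Rightarrow> bool) \<Rightarrow> real \<Rightarrow> bool" where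
  "first_time e i P t \<longleftrightarrow>
     recv_time e i \<le> t \<and> P t \<and> (\<forall>s. recv_time e i \<le> s \<and> s < t \<longrightarrow> \<not> P s)"

text \<open>The following relations state that the protocol lets \<open>i\<close> send the result \<open>(v, s)\<close> at time
  \<open>t\<close>.\<close>

definition result_FF :: "'c execution \<Rightarrow> 'c \<Rightarrow> vote \<Rightarrow> state \<Rightarrow> real \<Rightarrow> bool" where
  "result_FF e i v s t \<longleftrightarrow>
     v = vote_of e i \<and>
     (case v of
        No \<Rightarrow> s = Abort \<and> t = recv_time e i
      | Yes \<Rightarrow>
          if got_no e i (part_deadline e i) then s = Abort \<and> first_time e i (got_no e i) t
          else if got_all_yes e i (part_deadline e i)
            then s = Commit \<and> first_time e i (got_all_yes e i) t
          else s = Undecide \<and> t = part_deadline e i)"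

definition result_CF :: "'c execution \<Rightarrow> 'c \<Rightarrow> vote \<Rightarrow> state \<Rightarrow> real \<Rightarrow> bool" where
  "result_CF e i v s t \<longleftrightarrow>
     v = vote_of e i \<and>
     (case v of
        No \<Rightarrow> s = Abort \<and> t = recv_time e i
      | Yes \<Rightarrow>
          if got_all_yes e i (part_deadline e i)
            then s = Undecide \<and> first_time e i (got_all_yes e i) t
          else s = Abort \<and> recv_time e i \<le> t \<and> t \<le> part_deadline e i)"

text \<open>For the third protocol only the facts common to all protocols are recorded.\<close>

definition result_NF :: "'c execution \<Rightarrow> 'c \<Rightarrow> vote \<Rightarrow> state \<Rightarrow> real \<Rightarrow> bool" where
  "result_NF e i v s t \<longleftrightarrow> v = vote_of e i \<and> recv_time e i \<le> t"

definition protocol_result :: "'c execution \<Rightarrow> 'c \<Rightarrow> vote \<Rightarrow> state \<Rightarrow> real \<Rightarrow> bool" where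
  "protocol_result e =
     (case exec_level e of L_FF \<Rightarrow> result_FF e | L_CF \<Rightarrow> result_CF e | L_NF \<Rightarrow> result_NF e)"

definition result_msg :: "'c \<Rightarrow> vote \<Rightarrow> state \<Rightarrow> real \<Rightarrow> 'c message" where
  "result_msg c v s t = Message (Part c) Coord (Result v s) t"

definition sends_result :: "'c execution \<Rightarrow> 'c \<Rightarrow> bool" where
  "sends_result e c \<longleftrightarrow> (\<exists>v s t. result_msg c v s t \<in> msgs e)"

text \<open>
  Since the actions of a participant are ordered, a participant whose result has been sent has
  completed the broadcasts that precede it, even if it crashes at that very instant.
\<close>

locale flac_execution =
  fixes e :: "'c execution"
  assumes finite_participants: "finite (participants e)"
    and participants_nonempty: "participants e \<noteq> {}"
    and delay_bound_nonneg: "delay_bound e x y \<ge> 0"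
    and delay_nonneg: "m \<in> msgs e \<Longrightarrow> delay e m \<ge> 0"
    and endpoints: "m \<in> msgs e \<Longrightarrow>
          src m \<in> insert Coord (Part ` participants e) \<and>
          dst m \<in> insert Coord (Part ` participants e)"
    and sender_can_act: "m \<in> msgs e \<Longrightarrow> src m = Part c \<Longrightarrow> can_act e c (sent m)"
    and propose_sent: "c \<in> participants e \<Longrightarrow> propose_msg e c \<in> msgs e"
    and propose_only: "m \<in> msgs e \<Longrightarrow> payload m = Propose \<Longrightarrow>
          \<exists>c\<in>participants e. m = propose_msg e c"
    and votes_sent: "exec_level e \<noteq> L_NF \<Longrightarrow> c \<in> participants e \<Longrightarrow>
          alive e c (recv_time e c) \<or> sends_result e c \<Longrightarrow>
          d \<in> vote_receivers e c \<Longrightarrow> vote_msg e c d \<in> msgs e"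
    and votes_only: "exec_level e \<noteq> L_NF \<Longrightarrow> m \<in> msgs e \<Longrightarrow> payload m = Vote v \<Longrightarrow>
          \<exists>c\<in>participants e. \<exists>d\<in>vote_receivers e c. m = vote_msg e c d"
    and abort_broadcast: "exec_level e = L_CF \<Longrightarrow> result_msg c v Abort t \<in> msgs e \<Longrightarrow>
          d \<in> participants e \<Longrightarrow> Message (Part c) (Part d) (Decision Abort) t \<in> msgs e"
    and result_only: "m \<in> msgs e \<Longrightarrow> payload m = Result v s \<Longrightarrow>
          \<exists>c\<in>participants e. m = result_msg c v s (sent m) \<and> protocol_result e c v s (sent m)"
    and result_unique: "result_msg c v s t \<in> msgs e \<Longrightarrow> result_msg c v' s' t' \<in> msgs e \<Longrightarrow>
          v = v' \<and> s = s' \<and> t = t'"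
    and result_unless_crashed: "c \<in> participants e \<Longrightarrow>
          sends_result e c \<or> (\<exists>v s t. protocol_result e c v s t \<and> \<not> alive e c t)"
    and end_after_deadline: "coord_deadline e \<le> end_time e"
    and end_after_arrivals: "m \<in> msgs e \<Longrightarrow> arrival e m \<le> end_time e"


subsection \<open>Failures\<close>

datatype failure = Crash_Failure | Network_Failure

fun occurs :: "'c execution \<Rightarrow> failure \<Rightarrow> bool" where
  "occurs e Crash_Failure \<longleftrightarrow> (\<exists>c\<in>participants e. \<not> alive e c (end_time e))"
| "occurs e Network_Failure \<longleftrightarrow> (\<exists>m\<in>msgs e. delay e m > delay_bound e (src m) (dst m))"

fun expected :: "level \<Rightarrow> failure set" where
  "expected L_FF = {}"
| "expected L_CF = {Crash_Failure}"
| "expected L_NF = {Crash_Failure, Network_Failure}"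

definition unexpected_failure_occurs :: "'c execution \<Rightarrow> bool" where
  "unexpected_failure_occurs e \<longleftrightarrow> (\<exists>f. occurs e f \<and> f \<notin> expected (exec_level e))"


subsection \<open>The RLSM manager\<close>

text \<open>Results are tagged with their sender, so that equal results of different participants are
  counted separately.\<close>

definition results :: "'c execution \<Rightarrow> ('c \<times> vote \<times> state) set" where
  "results e = {(c, v, s). \<exists>t. result_msg c v s t \<in> msgs e \<and>
                             arrival e (result_msg c v s t) \<le> coord_deadline e}"

definition missing :: "'c execution \<Rightarrow> 'c set" where
  "missing e = {c \<in> participants e. \<nexists>v s. (c, v, s) \<in> results e}"

definition late :: "'c execution \<Rightarrow> 'c set" where
  "late e = {c \<in> participants e. \<exists>v s t. result_msg c v s t \<in> msgs e \<and>
                                   coord_deadline e < arrival e (result_msg c v s t)}"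

datatype event = CF | NF

text \<open>\<open>(ev, c) \<in> rlsm_events e\<close>: the manager sends \<open>ev\<close> to the state machine of \<open>c\<close>.\<close>

definition rlsm_events :: "'c execution \<Rightarrow> (event \<times> 'c) set" where
  "rlsm_events e =
     (case exec_level e of
        L_FF \<Rightarrow>
          if card (results e) < card (participants e) then {CF} \<times> missing e \<union> {NF} \<times> late e
          else if \<exists>c. (c, Yes, Undecide) \<in> results e then {NF} \<times> participants e
          else {}
      | L_CF \<Rightarrow>
          if card (results e) < card (participants e) then {NF} \<times> late e
          else if (\<exists>c. (c, Yes, Abort) \<in> results e) \<and> (\<nexists>c s. (c, No, s) \<in> results e)
            then {NF} \<times> participants e
          else {}
      | L_NF \<Rightarrow> {})"

end

theory Submission
  imports Defs
begin

text \<open>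
  Without network failures every vote sent on receipt of Propose arrives before the deadline of its
  receiver, which in turn leaves enough time for the result to reach the coordinator. Hence a late
  result is evidence of a network failure, a missing one of a crash or a network failure, and a
  participant that lacks a vote at its deadline is evidence that the vote was late or that its
  sender crashed. At level \<open>L_CF\<close> the latter is excluded if all results are present, since a
  participant votes before sending its result.
\<close>

lemma first_time_le:
  assumes "first_time e i P t" "P s" "recv_time e i \<le> s"
  shows "t \<le> s"
  using assms unfolding first_time_def by (meson not_le)

text \<open>Crashes are permanent, so a crash by time \<open>t\<close> still shows at
  \<open>end_time e\<close>, the only instant that \<open>occurs\<close> inspects.\<close>

lemma occurs_crash_failureI:
  assumes "c \<in> participants e" "\<not> alive e c t" "t \<le> end_time e"
  shows "occurs e Crash_Failure"
  using assms by (force simp: alive_def)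

context flac_execution
begin

lemma delay_le:
  assumes "\<not> occurs e Network_Failure" "m \<in> msgs e"
  shows "arrival e m \<le> sent m + delay_bound e (src m) (dst m)"
  using assms by (force simp: arrival_def)

lemma recv_time_le:
  assumes "\<not> occurs e Network_Failure" "i \<in> participants e"
  shows "recv_time e i \<le> start_time e + delay_bound e Coord (Part i)"
  using delay_le[OF assms(1) propose_sent[OF assms(2)]]
  by (simp add: recv_time_def propose_msg_def)

text \<open>\<open>part_timeout\<close> subtracts \<open>recv_time e i\<close> and the deadline adds
  it back, so the bound is an absolute time and holds however late Propose arrives.\<close>

lemma part_deadline_ge:
  assumes "j \<in> participants e"
  shows "start_time e + delay_bound e Coord (Part j) + delay_bound e (Part j) (Part i)
           \<le> part_deadline e i"
proof -
  have "start_time e + delay_bound e Coord (Part j) + delay_bound e (Part j) (Part i)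
          - recv_time e i \<le> part_timeout e i"
    unfolding part_timeout_def using assms finite_participants by (intro Max_ge) auto
  then show ?thesis by (simp add: part_deadline_def)
qed

text \<open>\<open>coord_timeout\<close> maximises over the same two-leg paths, each extended by the
  leg from \<open>i\<close> back to the coordinator.\<close>

lemma part_deadline_le:
  assumes "\<not> occurs e Network_Failure" "i \<in> participants e"
  shows "part_deadline e i + delay_bound e (Part i) Coord \<le> coord_deadline e"
proof -
  have coord: "start_time e + delay_bound e Coord (Part j) + delay_bound e (Part j) (Part i)
                 + delay_bound e (Part i) Coord \<le> coord_deadline e"
    if "j \<in> participants e" for j
  proof -
    \<comment> \<open>As the image of a finite product, the set of path lengths is finite and
      \<open>Max_ge\<close> applies.\<close>
    let ?f = "\<lambda>(i, j). delay_bound e Coord (Part j) + delay_bound e (Part j) (Part i)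
                        + delay_bound e (Part i) Coord"
    have "{delay_bound e Coord (Part j) + delay_bound e (Part j) (Part i)
             + delay_bound e (Part i) Coord | i j. i \<in> participants e \<and> j \<in> participants e}
          = ?f ` (participants e \<times> participants e)"
      by force
    then have "coord_timeout e = Max (?f ` (participants e \<times> participants e))"
      by (simp add: coord_timeout_def)
    moreover have "?f (i, j) \<le> Max (?f ` (participants e \<times> participants e))"
      using that assms(2) finite_participants by (intro Max_ge) auto
    ultimately show ?thesis by (simp add: coord_deadline_def)
  qed
  have "part_timeout e i \<in> {start_time e + delay_bound e Coord (Part j)
          + delay_bound e (Part j) (Part i) - recv_time e i | j. j \<in> participants e}"
    unfolding part_timeout_def using finite_participants participants_nonempty
    by (intro Max_in) auto
  then obtain j where "j \<in> participants e"
    "part_timeout e i = start_time e + delay_bound e Coord (Part j)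
       + delay_bound e (Part j) (Part i) - recv_time e i"
    by blast
  \<comment> \<open>The two cases of the \<open>max\<close> in \<open>part_deadline\<close>: the
    path via the maximising \<open>j\<close>, or a deadline clamped to \<open>recv_time e i\<close>,
    which is covered by the path via \<open>i\<close> itself.\<close>
  with coord[of j] coord[OF assms(2)] recv_time_le[OF assms]
    delay_bound_nonneg[of "Part i" "Part i"]
  show ?thesis by (simp add: part_deadline_def)
qed

text \<open>The conditions are tested at the deadline, so the first time at which one of them holds
  is no later. A \<open>No\<close> result is sent on receipt, and the deadline is clamped to at
  least that time.\<close>

lemma result_time_le:
  assumes "protocol_result e i v s t" "exec_level e \<noteq> L_NF"
  shows "t \<le> part_deadline e i"
proof -
  have "recv_time e i \<le> part_deadline e i" by (simp add: part_deadline_def)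
  with assms show ?thesis
    by (cases "exec_level e")
       (auto simp: protocol_result_def result_FF_def result_CF_def
         intro: first_time_le split: vote.splits if_splits)
qed

lemma result_msgD:
  assumes "result_msg c v s t \<in> msgs e"
  shows "c \<in> participants e \<and> protocol_result e c v s t"
  using result_only[OF assms] by (auto simp: result_msg_def)

lemma resultsD:
  assumes "(c, v, s) \<in> results e"
  obtains t where "c \<in> participants e" "protocol_result e c v s t" "sends_result e c"
  using assms result_msgD unfolding results_def sends_result_def by blast

lemma late_empty:
  assumes "\<not> occurs e Network_Failure" "exec_level e \<noteq> L_NF"
  shows "late e = {}"
proof -
  have "arrival e (result_msg c v s t) \<le> coord_deadline e"
    if "result_msg c v s t \<in> msgs e" for c v s t
    using delay_le[OF assms(1) that] result_time_le[of c v s t] result_msgD[OF that]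
      part_deadline_le[OF assms(1), of c] assms(2)
    by (simp add: result_msg_def)
  then show ?thesis by (force simp: late_def)
qed

lemma missing_empty:
  assumes "\<not> occurs e Network_Failure" "\<not> occurs e Crash_Failure" "exec_level e \<noteq> L_NF"
  shows "missing e = {}"
proof -
  have "\<exists>v s. (c, v, s) \<in> results e" if c: "c \<in> participants e" for c
  proof (cases "sends_result e c")
    case True
    then obtain v s t where m: "result_msg c v s t \<in> msgs e"
      by (auto simp: sends_result_def)
    moreover have "c \<notin> late e" using late_empty assms by blast
    ultimately have "arrival e (result_msg c v s t) \<le> coord_deadline e"
      using c by (force simp: late_def)
    with m show ?thesis by (auto simp: results_def)
  next
    case False
    then obtain v s t where "protocol_result e c v s t" "\<not> alive e c t"
      using result_unless_crashed[OF c] by blast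
    \<comment> \<open>The result is due by \<open>coord_deadline e\<close>, so the crash that
      prevents it falls within the execution.\<close>
    moreover from this have "t \<le> end_time e"
      using result_time_le[of c v s t] part_deadline_le[OF assms(1) c] assms(3)
        delay_bound_nonneg[of "Part c" Coord] end_after_deadline by linarith
    ultimately show ?thesis using occurs_crash_failureI[OF c, of t] assms(2) by simp
  qed
  then show ?thesis by (auto simp: missing_def)
qed

text \<open>The vote leaves at \<open>recv_time e j\<close> and follows one of the paths that
  \<open>part_deadline e i\<close> covers. That it was sent is known from \<open>j\<close> being
  alive on receipt or, where crashes are possible, from its result.\<close>

lemma has_vote_part_deadline:
  assumes "\<not> occurs e Network_Failure" "exec_level e \<noteq> L_NF"
    and "i \<in> participants e" "j \<in> participants e"
    and "alive e j (recv_time e j) \<or> sends_result e j"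
  shows "has_vote e i j (part_deadline e i)"
proof (cases "i \<in> vote_receivers e j")
  case True
  then have m: "vote_msg e j i \<in> msgs e" using votes_sent assms by blast
  have "arrival e (vote_msg e j i) \<le> part_deadline e i"
    using delay_le[OF assms(1) m] recv_time_le[OF assms(1,4)] part_deadline_ge[OF assms(4), of i]
    by (simp add: vote_msg_def)
  with m show ?thesis by (simp add: has_vote_def)
next
  case False
  with assms(3) have "j = i" by (auto simp: vote_receivers_def split: if_splits)
  with False show ?thesis by (simp add: has_vote_def)
qed

text \<open>A participant sends at most one result, so projecting to senders is injective and the
  count forces every participant to occur.\<close>

lemma result_if_card:
  assumes "card (participants e) \<le> card (results e)" "c \<in> participants e"
  obtains v s where "(c, v, s) \<in> results e"
proof -
  have inj: "inj_on fst (results e)"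
    by (rule inj_onI) (auto simp: results_def dest: result_unique)
  have sub: "fst ` results e \<subseteq> participants e" by (auto elim: resultsD)
  have "card (fst ` results e) = card (results e)" using inj by (rule card_image)
  then have "fst ` results e = participants e"
    using card_seteq[OF finite_participants sub] assms(1) by simp
  with assms(2) that show thesis by force
qed

lemma undecide_FF_imp_failure:
  assumes "exec_level e = L_FF" "(c, Yes, Undecide) \<in> results e"
  shows "occurs e Network_Failure \<or> occurs e Crash_Failure"
proof (rule ccontr)
  assume "\<not> ?thesis"
  then have nf: "\<not> occurs e Network_Failure" and cf: "\<not> occurs e Crash_Failure" by auto
  from assms(2) obtain t where c: "c \<in> participants e" and r: "protocol_result e c Yes Undecide t"
    by (rule resultsD)
  have "alive e j (recv_time e j)" if "j \<in> participants e" for j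
    using occurs_crash_failureI[OF that, of "recv_time e j"] cf
      end_after_arrivals[OF propose_sent[OF that]]
    unfolding recv_time_def by blast
  then have "has_vote e c j (part_deadline e c)" if "j \<in> participants e" for j
    using has_vote_part_deadline[OF nf _ c that] that assms(1) by simp
  \<comment> \<open>Once all votes are known, one is \<open>No\<close> or all are
    \<open>Yes\<close>; either branch of the protocol excludes \<open>Undecide\<close>.\<close>
  then have "got_no e c (part_deadline e c) \<or> got_all_yes e c (part_deadline e c)"
    unfolding got_no_def got_all_yes_def by (meson vote.exhaust)
  with r assms(1) show False
    by (auto simp: protocol_result_def result_FF_def split: if_splits)
qed

lemma abort_CF_imp_network_failure:
  assumes "exec_level e = L_CF" "(c, Yes, Abort) \<in> results e"
    and "card (participants e) \<le> card (results e)" "\<nexists>c s. (c, No, s) \<in> results e"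
  shows "occurs e Network_Failure"
proof (rule ccontr)
  assume nf: "\<not> occurs e Network_Failure"
  from assms(2) obtain t where c: "c \<in> participants e" and r: "protocol_result e c Yes Abort t"
    by (rule resultsD)
  have "vote_of e j = Yes \<and> has_vote e c j (part_deadline e c)" if j: "j \<in> participants e" for j
  proof -
    obtain v s where vs: "(j, v, s) \<in> results e" using result_if_card[OF assms(3) j] .
    then obtain t' where "protocol_result e j v s t'" "sends_result e j" by (rule resultsD)
    \<comment> \<open>A result carries the true vote of its sender, so the absence of
      \<open>No\<close> results makes every vote \<open>Yes\<close>.\<close>
    moreover have "v = Yes" using vs assms(4) by (cases v) auto
    ultimately show ?thesis using has_vote_part_deadline[OF nf _ c j] assms(1)
      by (simp add: protocol_result_def result_CF_def)
  qed
  then have "got_all_yes e c (part_deadline e c)" by (simp add: got_all_yes_def)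
  with r assms(1) show False by (simp add: protocol_result_def result_CF_def)
qed

end

theorem proposition6:
  fixes e :: "'c execution"
  assumes "flac_execution e"
    and "\<exists>c. (CF, c) \<in> rlsm_events e \<or> (NF, c) \<in> rlsm_events e"
  shows "unexpected_failure_occurs e"
proof -
  interpret flac_execution e by (rule assms(1))
  have ne: "rlsm_events e \<noteq> {}" using assms(2) by blast
  show ?thesis
  proof (cases "exec_level e")
    case L_FF
    with ne have "missing e \<noteq> {} \<or> late e \<noteq> {} \<or> (\<exists>c. (c, Yes, Undecide) \<in> results e)"
      by (auto simp: rlsm_events_def split: if_splits)
    then have "occurs e Network_Failure \<or> occurs e Crash_Failure"
      using missing_empty late_empty undecide_FF_imp_failure L_FF by (metis level.distinct(3))
    with L_FF show ?thesis unfolding unexpected_failure_occurs_def by (metis empty_iff expected.simps(1))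
  next
    case L_CF
    \<comment> \<open>The comparison of cardinalities stays in the second case: it ensures that
      every participant has a result and hence has voted.\<close>
    with ne have "late e \<noteq> {} \<or> card (participants e) \<le> card (results e) \<and>
        (\<exists>c. (c, Yes, Abort) \<in> results e) \<and> (\<nexists>c s. (c, No, s) \<in> results e)"
      by (auto simp: rlsm_events_def split: if_splits)
    then have "occurs e Network_Failure"
      using late_empty abort_CF_imp_network_failure L_CF by (metis level.distinct(5))
    with L_CF show ?thesis
      unfolding unexpected_failure_occurs_def by (intro exI[of _ Network_Failure]) simp
  next
    case L_NF
    with ne show ?thesis by (simp add: rlsm_events_def)
  qed
qed

end
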